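(* Let $\mathcal{H}$ be a nonzero real Hilbert space, and let $K_1$ and $K_2$ be nonempty closed convex cones in $\mathcal{H}$. Assume that $c_0(K_1,K_2)<1$. Then $K_1-K_2$ is closed.
   Context: A set $K\subseteq\mathcal{H}$ is a cone if $K=\mathbb{R}_{++}K$, where $\mathbb{R}_{++}=\{\lambda\in\mathbb{R}:\lambda>0\}$. $\mathbf{B}_{\mathcal{H}}=\{x\in\mathcal{H}:\|x\|\le 1\}$. $K_1-K_2=\{x-y : x\in K_1,\ y\in K_2\}$. For nonempty closed convex cones $K_1,K_2$, the cosine of the minimal angle between them is $$c_0(K_1,K_2):=\sup\{\langle x,y\rangle : x\in K_1\cap\mathbf{B}_{\mathcal{H}},\ y\in K_2\cap\mathbf{B}_{\mathcal{H}}\}.$$ *)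

theory Defs
  imports "HOL-Analysis.Analysis"
begin

(* Only strictly positive scalars: unlike the library's cone and conic, a nonempty
   pos_cone need not contain 0 (it does if it is also closed). *)
definition pos_cone :: "'a::real_vector set \<Rightarrow> bool" where
  "pos_cone K \<longleftrightarrow> K = {c *\<^sub>R x |c x. 0 < c \<and> x \<in> K}"

(* Sup on type real is meaningful only for nonempty sets that are bounded above; the two
   lemmas below show that this holds for nonempty closed cones. *)
definition cos_min_angle :: "'a::real_inner set \<Rightarrow> 'a set \<Rightarrow> real" where
  "cos_min_angle K1 K2 =
     Sup {x \<bullet> y |x y. x \<in> K1 \<inter> cball 0 1 \<and> y \<in> K2 \<inter> cball 0 1}"

lemma zero_in_closed_pos_cone:
  fixes K :: "'a::real_normed_vector set"
  assumes "pos_cone K" "closed K" "K \<noteq> {}"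
  shows "0 \<in> K"
proof -
  obtain x where x: "x \<in> K" using assms(3) by blast
  have "inverse (real (Suc n)) *\<^sub>R x \<in> K" for n
    using assms(1) x unfolding pos_cone_def
    by (metis (mono_tags, lifting) inverse_positive_iff_positive mem_Collect_eq of_nat_0_less_iff zero_less_Suc)
  moreover have "(\<lambda>n. inverse (real (Suc n)) *\<^sub>R x) \<longlonglongrightarrow> 0 *\<^sub>R x"
    by (intro tendsto_intros LIMSEQ_inverse_real_of_nat)
  ultimately show ?thesis
    using assms(2) closed_sequentially[of K "\<lambda>n. inverse (real (Suc n)) *\<^sub>R x"] by simp
qed

lemma cos_min_angle_bdd_nonempty:
  fixes K1 K2 :: "'a::real_inner set"
  shows "bdd_above {x \<bullet> y |x y. x \<in> K1 \<inter> cball 0 1 \<and> y \<in> K2 \<inter> cball 0 1}"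
    and "\<lbrakk>0 \<in> K1; 0 \<in> K2\<rbrakk> \<Longrightarrow>
           {x \<bullet> y |x y. x \<in> K1 \<inter> cball 0 1 \<and> y \<in> K2 \<inter> cball 0 1} \<noteq> {}"
proof -
  have "x \<bullet> y \<le> 1" if "x \<in> cball 0 1" "y \<in> cball 0 1" for x y :: 'a
  proof -
    have "x \<bullet> y \<le> norm x * norm y" by (rule norm_cauchy_schwarz)
    also have "\<dots> \<le> 1 * 1" using that by (intro mult_mono) auto
    finally show ?thesis by simp
  qed
  then show "bdd_above {x \<bullet> y |x y. x \<in> K1 \<inter> cball 0 1 \<and> y \<in> K2 \<inter> cball 0 1}"
    by (intro bdd_aboveI[of _ 1]) blast
  assume "0 \<in> K1" "0 \<in> K2"
  then show "{x \<bullet> y |x y. x \<in> K1 \<inter> cball 0 1 \<and> y \<in> K2 \<inter> cball 0 1} \<noteq> {}"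
    by fastforce
qed

end

theory Submission
  imports Defs
begin

text \<open>
  If \<open>c = c\<^sub>0(K\<^sub>1, K\<^sub>2) < 1\<close>, then \<open>(1 - c) (\<parallel>x\<parallel>\<^sup>2 + \<parallel>y\<parallel>\<^sup>2) \<le> \<parallel>x - y\<parallel>\<^sup>2\<close> on \<open>K\<^sub>1 \<times> K\<^sub>2\<close>.
  Hence, for \<open>z\<close> in the closure of \<open>K\<^sub>1 - K\<^sub>2\<close>, the pairs \<open>(x, y)\<close> in \<open>K\<^sub>1 \<times> K\<^sub>2\<close> with
  \<open>\<parallel>x - y - z\<parallel> \<le> 1/n\<close> form a decreasing sequence of nonempty bounded closed convex sets.
  Their intersection is nonempty, and any of its points represents \<open>z\<close>. This replaces
  weak compactness: points of almost minimal norm in the sets form a Cauchy sequence by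
  the parallelogram law.
\<close>

lemma decreasing_closed_convex_Inter_nonempty:
  fixes C :: "nat \<Rightarrow> 'a::{real_inner, complete_space} set"
  assumes dec: "decseq C" and ne: "\<And>n. C n \<noteq> {}" and cl: "\<And>n. closed (C n)"
    and cv: "\<And>n. convex (C n)" and bd: "bounded (C 0)"
  shows "(\<Inter>n. C n) \<noteq> {}"
proof -
  define m where "m n = Inf ((\<lambda>p. (norm p)\<^sup>2) ` C n)" for n
  have bb: "bdd_below ((\<lambda>p. (norm p)\<^sup>2) ` C n)" for n
    by (intro bdd_belowI2[of _ 0]) simp
  have sub: "C k \<subseteq> C n" if "n \<le> k" for n k
    using dec that by (auto simp: decseq_def)
  have m_le: "m n \<le> (norm p)\<^sup>2" if "p \<in> C n" for n p
    unfolding m_def using bb that by (intro cInf_lower) auto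
  have m_mono: "m n \<le> m k" if "n \<le> k" for n k
    unfolding m_def using that ne bb sub by (intro cInf_superset_mono image_mono) auto
  obtain B where B: "\<And>p. p \<in> C 0 \<Longrightarrow> norm p \<le> B"
    using bd by (auto simp: bounded_iff)
  have m_bound: "m n \<le> B\<^sup>2" for n
  proof -
    obtain p where p: "p \<in> C n" using ne by blast
    then have "norm p \<le> B" using sub[of 0 n] B by auto
    then have "(norm p)\<^sup>2 \<le> B\<^sup>2" by (intro power_mono) auto
    with m_le[OF p] show ?thesis by simp
  qed
  \<comment> \<open>The minimal squared norms increase as the sets shrink, and boundedness of
    \<open>C 0\<close> caps them, so they converge.\<close>
  obtain L where mL: "m \<longlonglongrightarrow> L" and m_le_L: "\<And>n. m n \<le> L"
    using incseq_convergent[of m "B\<^sup>2"] m_mono m_bound by (auto simp: incseq_def)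
  have "\<exists>p. p \<in> C n \<and> (norm p)\<^sup>2 < m n + inverse (real (Suc n))" for n
    using cInf_lessD[of "(\<lambda>p. (norm p)\<^sup>2) ` C n" "m n + inverse (real (Suc n))"] ne
    unfolding m_def by auto
  then obtain p where pC: "\<And>n. p n \<in> C n"
    and pm: "\<And>n. (norm (p n))\<^sup>2 < m n + inverse (real (Suc n))" by metis
  \<comment> \<open>By convexity the midpoint of \<open>p n\<close> and \<open>p k\<close> lies in
    \<open>C n\<close>, so its squared norm is at least \<open>m n\<close>; the parallelogram law
    then bounds the distance. The bound does not depend on \<open>k\<close> and tends to 0 with
    \<open>n\<close>.\<close>
  have est: "(dist (p n) (p k))\<^sup>2 \<le> 4 * (L - m n + inverse (real (Suc n)))" if "n \<le> k" for n k
  proof -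
    have "(1/2) *\<^sub>R p n + (1/2) *\<^sub>R p k \<in> C n"
      using pC sub[OF that] by (intro convexD[OF cv]) auto
    then have "m n \<le> (norm ((1/2) *\<^sub>R p n + (1/2) *\<^sub>R p k))\<^sup>2" by (rule m_le)
    then have "4 * m n \<le> (norm (p n + p k))\<^sup>2"
      by (simp flip: scaleR_add_right add: power_mult_distrib power_divide)
    moreover have "(norm (p n + p k))\<^sup>2 + (dist (p n) (p k))\<^sup>2 = 2 * (norm (p n))\<^sup>2 + 2 * (norm (p k))\<^sup>2"
      by (simp add: dist_norm power2_norm_eq_inner inner_simps inner_commute)
    moreover have "inverse (real (Suc k)) \<le> inverse (real (Suc n))"
      using that by (intro le_imp_inverse_le) auto
    ultimately show ?thesis
      using pm[of n] pm[of k] m_le_L[of n] m_le_L[of k] by argo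
  qed
  have "(\<lambda>n. 4 * (L - m n + inverse (real (Suc n)))) \<longlonglongrightarrow> 4 * (L - L + 0)"
    by (intro tendsto_intros mL LIMSEQ_inverse_real_of_nat)
  then have lim: "(\<lambda>n. 4 * (L - m n + inverse (real (Suc n)))) \<longlonglongrightarrow> 0" by simp
  have "Cauchy p"
  proof (rule CauchyI')
    fix e :: real assume e: "0 < e"
    then obtain N where N: "\<And>n. N \<le> n \<Longrightarrow> 4 * (L - m n + inverse (real (Suc n))) < e\<^sup>2"
      using order_tendstoD(2)[OF lim, of "e\<^sup>2"] by (auto simp: eventually_sequentially)
    have "dist (p n) (p k) < e" if "N \<le> n" "n < k" for n k
      using est[of n k] N[of n] that e power2_less_imp_less[of "dist (p n) (p k)" e] by simp
    then show "\<exists>M. \<forall>m\<ge>M. \<forall>n>m. dist (p m) (p n) < e" by blast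
  qed
  then obtain l where l: "p \<longlonglongrightarrow> l" using Cauchy_convergent convergent_def by blast
  have "l \<in> C n" for n
  proof (rule Lim_in_closed_set[OF cl _ _ l])
    show "\<forall>\<^sub>F k in sequentially. p k \<in> C n"
      using eventually_ge_at_top[of n] by eventually_elim (use pC sub in blast)
  qed simp
  then show ?thesis by blast
qed

lemma pos_cone_scaleR: "pos_cone K \<Longrightarrow> 0 < c \<Longrightarrow> x \<in> K \<Longrightarrow> c *\<^sub>R x \<in> K"
  unfolding pos_cone_def by blast

text \<open>Dividing nonzero vectors by their norms keeps them in the cones and puts them into the
  unit ball, where the supremum applies. If one vector is zero, both sides vanish.\<close>

lemma inner_le_cos_min_angle:
  assumes "pos_cone K1" "pos_cone K2" "x \<in> K1" "y \<in> K2"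
  shows "x \<bullet> y \<le> cos_min_angle K1 K2 * (norm x * norm y)"
proof (cases "x = 0 \<or> y = 0")
  case False
  have "(inverse (norm x) *\<^sub>R x) \<bullet> (inverse (norm y) *\<^sub>R y) \<le> cos_min_angle K1 K2"
    unfolding cos_min_angle_def
  proof (rule cSup_upper[OF _ cos_min_angle_bdd_nonempty(1)])
    have "inverse (norm x) *\<^sub>R x \<in> K1 \<inter> cball 0 1" "inverse (norm y) *\<^sub>R y \<in> K2 \<inter> cball 0 1"
      using False assms by (auto intro!: pos_cone_scaleR)
    then show "(inverse (norm x) *\<^sub>R x) \<bullet> (inverse (norm y) *\<^sub>R y)
        \<in> {x \<bullet> y |x y. x \<in> K1 \<inter> cball 0 1 \<and> y \<in> K2 \<inter> cball 0 1}" by blast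
  qed
  then show ?thesis using False by (simp add: field_simps)
qed auto

text \<open>The pair (0, 0) contributes the value 0 to the supremum.\<close>

lemma cos_min_angle_nonneg:
  assumes "0 \<in> K1" "0 \<in> K2"
  shows "0 \<le> cos_min_angle K1 K2"
  unfolding cos_min_angle_def
  by (rule cSup_upper[OF _ cos_min_angle_bdd_nonempty(1)]) (use assms in force)

text \<open>Coercivity of the difference map on \<open>K1\<close> \<times> \<open>K2\<close>: expand
  the square, bound the inner product by the cosine, and apply 2ab \<le> a^2 + b^2, which may be
  multiplied by the cosine because that is nonnegative.\<close>

lemma norm_diff_ge_cos_min_angle:
  assumes "pos_cone K1" "pos_cone K2" "0 \<in> K1" "0 \<in> K2" "x \<in> K1" "y \<in> K2"
  shows "(1 - cos_min_angle K1 K2) * ((norm x)\<^sup>2 + (norm y)\<^sup>2) \<le> (norm (x - y))\<^sup>2"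
proof -
  let ?c = "cos_min_angle K1 K2"
  have "2 * (norm x * norm y) \<le> (norm x)\<^sup>2 + (norm y)\<^sup>2"
    using sum_squares_bound[of "norm x" "norm y"] by simp
  then have "?c * (2 * (norm x * norm y)) \<le> ?c * ((norm x)\<^sup>2 + (norm y)\<^sup>2)"
    using cos_min_angle_nonneg[OF assms(3,4)] by (rule mult_left_mono)
  moreover have "x \<bullet> y \<le> ?c * (norm x * norm y)"
    using assms by (intro inner_le_cos_min_angle)
  moreover have "(norm (x - y))\<^sup>2 = (norm x)\<^sup>2 + (norm y)\<^sup>2 - 2 * (x \<bullet> y)"
    by (simp add: power2_norm_eq_inner inner_simps inner_commute)
  ultimately show ?thesis by (simp add: algebra_simps)
qed

theorem theorem4p7:
  fixes K1 K2 :: "'a::{real_inner, complete_space} set"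
  assumes "\<exists>x::'a. x \<noteq> 0"
    and "K1 \<noteq> {}" and "closed K1" and "convex K1" and "pos_cone K1"
    and "K2 \<noteq> {}" and "closed K2" and "convex K2" and "pos_cone K2"
    and "cos_min_angle K1 K2 < 1"
  shows "closed {x - y |x y. x \<in> K1 \<and> y \<in> K2}"
proof -
  let ?S = "{x - y |x y. x \<in> K1 \<and> y \<in> K2}"
  let ?c = "cos_min_angle K1 K2"
  have zero: "0 \<in> K1" "0 \<in> K2" using assms zero_in_closed_pos_cone by blast+
  have "z \<in> ?S" if z: "z \<in> closure ?S" for z
  proof -
    \<comment> \<open>Working with pairs in the product Hilbert space, rather than with differences,
      lets one point of the intersection supply both components of \<open>z\<close>.\<close>
    define C where "C n = (K1 \<times> K2) \<inter> (\<lambda>p. fst p - snd p) -` cball z (inverse (real (Suc n)))" for n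
    have lin: "linear (\<lambda>p::'a \<times> 'a. fst p - snd p)"
      by (intro linear_compose_sub linear_fst linear_snd)
    have "(\<Inter>n. C n) \<noteq> {}"
    proof (rule decreasing_closed_convex_Inter_nonempty)
      show "decseq C"
      proof (rule decseq_SucI)
        fix n
        have "inverse (real (Suc (Suc n))) \<le> inverse (real (Suc n))"
          by (intro le_imp_inverse_le) auto
        then have "cball z (inverse (real (Suc (Suc n)))) \<subseteq> cball z (inverse (real (Suc n)))"
          by (rule subset_cball)
        then show "C (Suc n) \<subseteq> C n" unfolding C_def by blast
      qed
      show "C n \<noteq> {}" for n
      proof -
        obtain x y where xy: "x \<in> K1" "y \<in> K2" "dist (x - y) z < inverse (real (Suc n))"
          using z closure_approachable[of z ?S]
          by (smt (verit, best) inverse_positive_iff_positive mem_Collect_eq of_nat_0_less_iff zero_less_Suc)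
        then have "(x, y) \<in> C n" by (simp add: C_def dist_commute)
        then show ?thesis by blast
      qed
      show "closed (C n)" for n
        unfolding C_def using assms
        by (intro closed_Int closed_Times closed_vimage continuous_intros) auto
      show "convex (C n)" for n
        unfolding C_def using assms lin
        by (intro convex_Int convex_Times convex_linear_vimage convex_cball) auto
      show "bounded (C 0)"
        unfolding bounded_iff
      proof (intro exI ballI)
        fix p assume "p \<in> C 0"
        \<comment> \<open>The ball defining \<open>C 0\<close> has radius 1.\<close>
        then obtain x y where p: "p = (x, y)" "x \<in> K1" "y \<in> K2" "dist z (x - y) \<le> 1"
          by (auto simp: C_def)
        have "norm (x - y) \<le> norm z + 1"
          using p(4) norm_triangle_ineq2[of "x - y" z] by (simp add: dist_norm norm_minus_commute)
        then have "(norm (x - y))\<^sup>2 \<le> (norm z + 1)\<^sup>2" by (intro power_mono) auto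
        with norm_diff_ge_cos_min_angle[OF assms(5,9) zero p(2,3)]
        have "(1 - ?c) * ((norm x)\<^sup>2 + (norm y)\<^sup>2) \<le> (norm z + 1)\<^sup>2"
          by (rule order_trans)
        \<comment> \<open>Here \<open>?c\<close> < 1 makes the divisor positive; the left side is
          the squared norm of the pair.\<close>
        then have "(norm x)\<^sup>2 + (norm y)\<^sup>2 \<le> (norm z + 1)\<^sup>2 / (1 - ?c)"
          using assms(10) by (simp add: field_simps)
        then show "norm p \<le> sqrt ((norm z + 1)\<^sup>2 / (1 - ?c))"
          by (simp add: p(1) norm_Pair)
      qed
    qed
    then obtain p where p: "\<And>n. p \<in> C n" by blast
    have "dist z (fst p - snd p) \<le> inverse (real (Suc n))" for n
      using p[of n] by (simp add: C_def)
    then have "dist z (fst p - snd p) \<le> 0"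
      using LIMSEQ_le_const[OF LIMSEQ_inverse_real_of_nat] by blast
    then have "z = fst p - snd p" by simp
    moreover have "fst p \<in> K1" "snd p \<in> K2" using p[of 0] by (auto simp: C_def)
    ultimately show ?thesis by blast
  qed
  then show ?thesis by (intro iffD1[OF closure_subset_eq] subsetI)
qed

end
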